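(* For all integers $k\ge 0$ and $n\ge m\ge 1$, \[ f(k,m,n)\ge\Bigl((\sqrt{k^2+1}-k)m-\tfrac12\Bigr)n-\frac{m^2}{2}. \]
   Context: For a finite set $A\subseteq\mathbb{Z}$ and a positive integer $m$, $\Psi_m(A)$ denotes the number of pairs $(x,y)\in A^2$ with $x<y\le x+m$. For integers $k\ge0$ and $m,n\ge1$, $f(k,m,n)$ denotes the minimum of $\Psi_m(A_1)+\dots+\Psi_m(A_{k+1})$ over all partitions $\{1,\dots,n\}=A_1\cup\dots\cup A_{k+1}$ into $k+1$ pairwise disjoint (possibly empty) sets; equivalently, the minimum number of monochromatic edges in a vertex $(k+1)$-colouring of the $m$-th power of the path on $n$ vertices. *)

theory Defs
  imports Complex_Main "HOL-Library.Disjoint_Sets"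
begin

definition Psi :: "nat \<Rightarrow> int set \<Rightarrow> nat" where
  "Psi m A = card {(x, y). x \<in> A \<and> y \<in> A \<and> x < y \<and> y \<le> x + int m}"

text \<open>Only the blocks with index in \<open>{1..k + 1}\<close> are constrained, and they may be empty
  (so this is not \<open>partition_on\<close>).\<close>

definition is_partition :: "nat \<Rightarrow> nat \<Rightarrow> (nat \<Rightarrow> int set) \<Rightarrow> bool" where
  "is_partition k n A \<longleftrightarrow>
     disjoint_family_on A {1..k + 1} \<and> (\<Union>i\<in>{1..k + 1}. A i) = {1..int n}"

definition min_Psi :: "nat \<Rightarrow> nat \<Rightarrow> nat \<Rightarrow> nat" where
  "min_Psi k m n = (LEAST s. \<exists>A. is_partition k n A \<and> s = (\<Sum>i = 1..k + 1. Psi m (A i)))"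

text \<open>The minimum is over a nonempty set of values, hence attained.\<close>

lemma is_partition_exists: "\<exists>A. is_partition k n A"
proof
  show "is_partition k n (\<lambda>i. if i = 1 then {1..int n} else {})"
    by (auto simp: is_partition_def disjoint_family_on_def)
qed

lemma min_Psi_attained:
  "\<exists>A. is_partition k n A \<and> min_Psi k m n = (\<Sum>i = 1..k + 1. Psi m (A i))"
  unfolding min_Psi_def by (rule LeastI_ex) (use is_partition_exists in blast)

lemma min_Psi_le:
  "is_partition k n A \<Longrightarrow> min_Psi k m n \<le> (\<Sum>i = 1..k + 1. Psi m (A i))"
  unfolding min_Psi_def by (rule Least_le) blast

end

theory Submission
  imports Defs
begin

text \<open>
  Let \<open>A\<close> be one class and \<open>B\<close> its complement in \<open>{1..n}\<close>. Up to boundary terms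
  \<open>\<Psi>\<^sub>m(A)\<close> is \<open>m |A|\<close> minus the number of pairs \<open>x \<in> A\<close>, \<open>y \<in> B\<close> with \<open>0 < y - x \<le> m\<close>.
  For \<open>L\<^sup>2 + G\<^sup>2 = m\<^sup>2\<close> these pairs number at most \<open>(m - L) |A| + (m - G) |B|\<close>, pairs with
  \<open>y - x = m\<close> counting one half. This is a charging argument: a pair with \<open>h\<close> elements of \<open>A\<close>
  and \<open>v\<close> elements of \<open>B\<close> strictly in between splits its unit weight into an increment
  \<open>lam h (v + 1) - lam h v\<close> charged to \<open>x\<close> and an increment \<open>mu (h + 1) v - mu h v\<close> charged
  to \<open>y\<close>. Since \<open>lam\<close> is also increasing in \<open>h\<close> and \<open>mu\<close> in \<open>v\<close>, the charges at a point
  telescope along the sequence, to at most \<open>sup lam \<le> m - L\<close> at \<open>x\<close> and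
  \<open>sup mu \<le> m - G\<close> at \<open>y\<close>, whatever the order of the letters.
  In the continuous picture \<open>x\<close> pays at the constant rate \<open>(m - L) / V h\<close> for
  \<open>v \<le> V h = sqrt (level h)\<close>, where \<open>level\<close> falls linearly from \<open>G\<^sup>2\<close> with slope
  \<open>-2 (m - L)\<close>; discretely, this rate is averaged over unit cells of the \<open>(h, v)\<close>-plane.
  Taking \<open>L = m / sqrt (k\<^sup>2 + 1)\<close>, \<open>G = k L\<close> and summing over the classes gives the bound:
  the classes have total size \<open>n\<close>, their complements \<open>k n\<close>. The block length \<open>L\<close> and gap
  \<open>G\<close> are those of the asymptotically extremal cyclic colouring.
\<close>

section \<open>Concavity of \<open>area\<close> and monotonicity of its increments\<close>

text \<open>For \<open>z \<ge> 0\<close>, \<open>area v z\<close> is the integral of \<open>max t (sqrt z)\<close> over \<open>0 \<le> t \<le> v\<close>. The second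
  branch also covers \<open>z < 0\<close>, which keeps \<open>area v\<close> concave on the whole line.\<close>

definition area :: "nat \<Rightarrow> real \<Rightarrow> real" where
  "area v z = (if (real v)\<^sup>2 \<le> z then real v * sqrt z else ((real v)\<^sup>2 + z) / 2)"

definition strip :: "nat \<Rightarrow> real \<Rightarrow> real" where
  "strip v z = area (Suc v) z - area v z"

text \<open>AM-GM gives the first branch. In the second, the right side minus the left is
  \<open>(c - v) * (v * c - z) / (2 * c)\<close>.\<close>

lemma area_le_affine:
  assumes "real v \<le> c" "0 < c"
  shows "area v z \<le> real v * (z / c + c) / 2"
proof (cases "(real v)\<^sup>2 \<le> z")
  case True
  then have "0 \<le> z" by (meson order_trans zero_le_power2)
  have "0 \<le> (sqrt z - c)\<^sup>2" by simp
  then have "2 * sqrt z * c \<le> z + c\<^sup>2"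
    using \<open>0 \<le> z\<close> by (simp add: power2_diff)
  then have "sqrt z \<le> (z / c + c) / 2"
    using assms by (simp add: field_simps power2_eq_square)
  then have "real v * sqrt z \<le> real v * ((z / c + c) / 2)"
    by (intro mult_left_mono) auto
  then show ?thesis using True by (simp add: area_def)
next
  case False
  have "0 \<le> (c - real v) * (real v * c - z)"
  proof -
    have "(real v)\<^sup>2 \<le> real v * c"
      using assms by (simp add: power2_eq_square mult_left_mono)
    then show ?thesis using False assms by simp
  qed
  then have "((real v)\<^sup>2 + z) / 2 \<le> real v * (z / c + c) / 2"
    using assms by (simp add: field_simps power2_eq_square)
  then show ?thesis using False by (simp add: area_def)
qed

text \<open>The affine majorants above touch \<open>area v\<close> at every point, so it is concave.\<close>

lemma area_supergradient:
  obtains s where "0 \<le> s" "s \<le> 1 / 2" "\<And>z'. area v z' \<le> area v z + s * (z' - z)"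
proof (cases "v = 0")
  case True
  show thesis
    by (rule that[of "if 0 \<le> z then 0 else 1 / 2"]) (auto simp: area_def True field_simps)
next
  case False
  define c where "c = max (real v) (sqrt z)"
  have c: "real v \<le> c" "0 < c" using False by (auto simp: c_def)
  have eq: "area v z = real v * (z / c + c) / 2"
  proof (cases "(real v)\<^sup>2 \<le> z")
    case True
    then have "c = sqrt z" "0 \<le> z"
      by (auto simp: c_def real_le_rsqrt max_def intro: order_trans[OF zero_le_power2])
    then show ?thesis using True by (simp add: area_def real_div_sqrt)
  next
    case nle: False
    then have "sqrt z \<le> real v" using real_sqrt_le_mono[of z "(real v)\<^sup>2"] by simp
    then have "c = real v" by (simp add: c_def)
    then show ?thesis using nle False by (simp add: area_def power2_eq_square field_simps)
  qed
  show thesis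
  proof (rule that[of "real v / (2 * c)"])
    show "area v z' \<le> area v z + real v / (2 * c) * (z' - z)" for z'
    proof -
      have "real v * (z' / c + c) / 2 = area v z + real v / (2 * c) * (z' - z)"
        using c(2) by (simp add: eq field_simps)
      then show ?thesis using area_le_affine[OF c, of z'] by (simp only:)
    qed
  qed (use c in \<open>auto simp: field_simps\<close>)
qed

lemma area_concave: "area v (z + 2 * d) - area v (z + d) \<le> area v (z + d) - area v z"
proof -
  obtain s where s: "\<And>z'. area v z' \<le> area v (z + d) + s * (z' - (z + d))"
    using area_supergradient by metis
  show ?thesis using s[of "z + 2 * d"] s[of z] by (simp add: algebra_simps)
qed

lemma area_increment:
  assumes "0 \<le> d"
  shows "area v z \<le> area v (z + d)" "area v (z + d) - area v z \<le> d / 2"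
proof -
  obtain s where s: "0 \<le> s" "\<And>z'. area v z' \<le> area v (z + d) + s * (z' - (z + d))"
    using area_supergradient by metis
  show "area v z \<le> area v (z + d)" using s(2)[of z] s(1) assms
    by (smt (verit) mult_nonneg_nonneg mult_minus_right)
  obtain s where s: "s \<le> 1 / 2" "\<And>z'. area v z' \<le> area v z + s * (z' - z)"
    using area_supergradient by metis
  show "area v (z + d) - area v z \<le> d / 2"
    using s(2)[of "z + d"] mult_right_mono[OF s(1) assms] by simp
qed

text \<open>The value is the average of \<open>max t (sqrt z)\<close> over
  \<open>v <= t <= v + 1\<close>, also for negative \<open>z\<close>, whose \<open>sqrt\<close> is
  negative.\<close>

lemma strip_eq:
  "strip v z = (let c = max (real v) (sqrt z) in c + (max 0 (real v + 1 - c))\<^sup>2 / 2)"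
proof -
  consider "z < (real v)\<^sup>2" | "(real v)\<^sup>2 \<le> z" "z < (real (Suc v))\<^sup>2" | "(real (Suc v))\<^sup>2 \<le> z"
    by linarith
  then show ?thesis
  proof cases
    case 1
    then have "sqrt z \<le> real v"
      using real_sqrt_le_mono[of z "(real v)\<^sup>2"] by simp
    moreover have "z < (real (Suc v))\<^sup>2"
      using 1 by (simp add: power2_eq_square algebra_simps)
    ultimately show ?thesis
      using 1 by (simp add: strip_def area_def Let_def power2_eq_square field_simps)
  next
    case 2
    then have c: "0 \<le> z" "real v \<le> sqrt z" "sqrt z < real v + 1"
      using real_sqrt_less_mono[OF 2(2)]
      by (auto simp: real_le_rsqrt intro: order_trans[OF zero_le_power2])
    define c where "c = sqrt z"
    then have "z = c\<^sup>2" using c(1) by simp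
    then show ?thesis
      using 2 c c_def[symmetric]
      by (simp add: strip_def area_def Let_def power2_eq_square field_simps del: real_sqrt_pow2)
  next
    case 3
    then have "real v + 1 \<le> sqrt z"
      by (auto simp: real_le_rsqrt add.commute)
    moreover have "(real v)\<^sup>2 \<le> z"
      using 3 by (smt (verit) of_nat_0_le_iff of_nat_Suc power_mono)
    ultimately show ?thesis
      using 3 by (simp add: strip_def area_def Let_def field_simps)
  qed
qed

lemma strip_bounds: "max (real v) (sqrt z) \<le> strip v z" "strip v z \<le> max (real v + 1) (sqrt z)"
proof -
  define c where "c = max (real v) (sqrt z)"
  have eq: "strip v z = c + (max 0 (real v + 1 - c))\<^sup>2 / 2"
    by (simp add: strip_eq c_def Let_def)
  then show "max (real v) (sqrt z) \<le> strip v z" by (simp add: c_def)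
  define p where "p = max 0 (real v + 1 - c)"
  have p: "0 \<le> p" "p \<le> 1" "c + p = max (real v + 1) (sqrt z)" by (auto simp: p_def c_def)
  then have "p\<^sup>2 \<le> p" by (simp add: power2_eq_square mult_left_le)
  then show "strip v z \<le> max (real v + 1) (sqrt z)"
    using p eq by (simp add: p_def[symmetric])
qed

lemma strip_mono:
  assumes "z \<le> z'"
  shows "strip v z \<le> strip v z'"
proof -
  define c where "c = max (real v) (sqrt z)"
  define c' where "c' = max (real v) (sqrt z')"
  have "sqrt z \<le> sqrt z'" using assms by simp
  then have cc: "real v \<le> c" "c \<le> c'"
    unfolding c_def c'_def by (simp_all only: max.mono max.cobounded1 order_refl)
  define p where "p = max 0 (real v + 1 - c)"
  define q where "q = max 0 (real v + 1 - c')"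
  have pq: "0 \<le> q" "q \<le> p" "p \<le> 1" "p - q \<le> c' - c" using cc by (auto simp: p_def q_def)
  have "(p - q) * (p + q) \<le> (p - q) * 2" using pq by (intro mult_left_mono) auto
  then have "p\<^sup>2 - q\<^sup>2 \<le> 2 * (c' - c)" using pq by (simp add: power2_eq_square algebra_simps)
  moreover have "strip v z = c + p\<^sup>2 / 2" "strip v z' = c' + q\<^sup>2 / 2"
    by (simp_all add: strip_eq Let_def c_def c'_def p_def q_def)
  ultimately show ?thesis by (simp add: field_simps)
qed

lemma strip_Suc: "strip v z \<le> strip (Suc v) z"
  using strip_bounds(2)[of v z] strip_bounds(1)[of "Suc v" z] by (simp only: of_nat_Suc add.commute)

lemma strip_small: "z \<le> (real v)\<^sup>2 \<Longrightarrow> strip v z = real v + 1 / 2"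
  using real_sqrt_le_mono[of z "(real v)\<^sup>2"] by (simp add: strip_eq Let_def)

section \<open>Charging functions and the weight of one pair\<close>

locale budget =
  fixes m :: nat and L :: real
  assumes L: "0 \<le> L" "L \<le> real m"
begin

definition "G = sqrt ((real m)\<^sup>2 - L\<^sup>2)"

definition level :: "nat \<Rightarrow> real" where
  "level h = (real m)\<^sup>2 - L\<^sup>2 - 2 * real h * (real m - L)"

text \<open>As \<open>area v\<close> has slope \<open>min 1 (v / sqrt z) / 2\<close> at
  \<open>z > 0\<close>, this is, for positive levels, the integral of
  \<open>(m - L) * min 1 (v / V s)\<close> over \<open>h <= s <= h + 1\<close>.\<close>

definition lam :: "nat \<Rightarrow> nat \<Rightarrow> real" where
  "lam h v = area v (level h) - area v (level (Suc h))"

text \<open>Freezing the value at the cap \<open>m - G\<close> makes pairs at distance above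
  \<open>m\<close> charge nothing to \<open>y\<close>.\<close>

definition mu :: "nat \<Rightarrow> nat \<Rightarrow> real" where
  "mu h v = (if h + v < m then real h - G + strip v (level h) else real m - G)"

lemma level_Suc: "level h = level (Suc h) + 2 * (real m - L)"
  by (simp add: level_def algebra_simps)

lemma level_le: "level h \<le> (real m - real h)\<^sup>2"
proof -
  have "(real m - real h)\<^sup>2 - level h = (L - real h)\<^sup>2"
    by (simp add: level_def power2_eq_square algebra_simps)
  then show ?thesis by (smt (verit) zero_le_power2)
qed

lemma lam_nonneg: "0 \<le> lam h v"
  and lam_le: "lam h v \<le> real m - L"
  using area_increment[of "2 * (real m - L)" v "level (Suc h)"] L by (simp_all add: lam_def level_Suc[of h])

lemma lam_Suc: "lam h v \<le> lam (Suc h) v"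
  using area_concave[of v "level (Suc (Suc h))" "2 * (real m - L)"]
  by (simp add: lam_def level_Suc[of h] level_Suc[of "Suc h"] algebra_simps)

lemma lam_diff: "lam h (Suc v) - lam h v = strip v (level h) - strip v (level (Suc h))"
  by (simp add: lam_def strip_def)

lemma lam_diff_nonneg: "lam h v \<le> lam h (Suc v)"
  using strip_mono[of "level (Suc h)" "level h" v] lam_diff[of h v] level_Suc[of h] L by simp

lemma strip_le:
  assumes "h + v < m"
  shows "strip v (level h) \<le> real m - real h"
proof -
  have "sqrt (level h) \<le> real m - real h"
    using real_sqrt_le_mono[OF level_le[of h]] assms by simp
  moreover have "real v + 1 \<le> real m - real h" using assms by linarith
  ultimately show ?thesis using strip_bounds(2)[of v "level h"] by linarith
qed

lemma mu_le: "mu h v \<le> real m - G"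
  using strip_le[of h v] by (auto simp: mu_def)

lemma mu_Suc: "mu h v \<le> mu h (Suc v)"
  using mu_le[of h v] strip_Suc[of v "level h"] by (auto simp: mu_def)

lemma mu_0: "0 \<le> mu 0 v"
proof (cases "v < m")
  case True
  have "level 0 = (real m)\<^sup>2 - L\<^sup>2" by (simp add: level_def)
  then show ?thesis using strip_bounds(1)[of v "level 0"] True by (simp add: mu_def G_def)
next
  case False
  have "G \<le> sqrt ((real m)\<^sup>2)" unfolding G_def by (intro real_sqrt_le_mono) simp
  then show ?thesis using False by (simp add: mu_def)
qed

definition weight :: "nat \<Rightarrow> real" where
  "weight d = (if d < m then 1 else if d = m then 1 / 2 else 0)"

text \<open>Below distance \<open>m\<close> the \<open>strip\<close> terms cancel and leave exactly
  1. At distance \<open>m\<close> the cap replaces \<open>mu (Suc h) v\<close>, and the remaining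
  \<open>strip\<close> value \<open>v + 1/2\<close> leaves only 1/2.\<close>

lemma weight_le: "weight (Suc (h + v)) \<le> (lam h (Suc v) - lam h v) + (mu (Suc h) v - mu h v)"
proof -
  consider "Suc (h + v) < m" | "Suc (h + v) = m" | "m < Suc (h + v)" by linarith
  then show ?thesis
  proof cases
    case 1
    then show ?thesis by (simp add: weight_def lam_diff mu_def)
  next
    case 2
    then have "real v = real m - real (Suc h)" by simp
    then have "strip v (level (Suc h)) = real v + 1 / 2"
      using level_le[of "Suc h"] by (intro strip_small) simp
    then show ?thesis using 2 by (auto simp: weight_def lam_diff mu_def)
  next
    case 3
    then show ?thesis using lam_diff_nonneg[of h v] by (simp add: weight_def mu_def)
  qed
qed

end

section \<open>Telescoping the charges\<close>

definition between :: "int set \<Rightarrow> int \<Rightarrow> int \<Rightarrow> nat" where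
  "between S x y = card (S \<inter> {x<..<y})"

lemma open_empty: "{x<..<x + 1 :: int} = {}" "{y - 1<..<y :: int} = {}"
  by auto

lemma open_upper: "{x<..<x + 1 + int (Suc j)} = insert (x + 1 + int j) {x<..<x + 1 + int j}"
  by auto

lemma open_lower: "{y - 1 - int (Suc j)<..<y} = insert (y - 1 - int j) {y - 1 - int j<..<y}"
  by auto

lemma between_compl:
  assumes "x < y"
  shows "between A x y + between (- A) x y = nat (y - x) - 1"
proof -
  have "between A x y + between (- A) x y = card ((A \<inter> {x<..<y}) \<union> (- A \<inter> {x<..<y}))"
    unfolding between_def by (subst card_Un_disjoint) auto
  also have "(A \<inter> {x<..<y}) \<union> (- A \<inter> {x<..<y}) = {x<..<y}" by auto
  finally show ?thesis using assms by simp
qed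

context budget
begin

abbreviation "lam_at A x y \<equiv>
  lam (between A x y) (Suc (between (- A) x y)) - lam (between A x y) (between (- A) x y)"

abbreviation "mu_at A x y \<equiv>
  mu (Suc (between A x y)) (between (- A) x y) - mu (between A x y) (between (- A) x y)"

text \<open>Passing a point outside \<open>A\<close> raises \<open>lam\<close> by exactly the new
  summand; passing a point of \<open>A\<close> adds no summand and does not lower
  \<open>lam\<close>.\<close>

lemma sum_lam_le:
  "(\<Sum>y\<in>- A \<inter> {x<..<x + 1 + int j}. lam_at A x y)
     \<le> lam (between A x (x + 1 + int j)) (between (- A) x (x + 1 + int j))"
proof (induction j)
  case 0
  then show ?case by (simp add: lam_nonneg open_empty)
next
  case (Suc j)
  show ?case
  proof (cases "x + 1 + int j \<in> A")
    case True
    then show ?thesis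
      using Suc lam_Suc[of "between A x (x + 1 + int j)" "between (- A) x (x + 1 + int j)"]
      by (simp add: between_def open_upper Int_insert_right del: of_nat_Suc)
  next
    case False
    then show ?thesis
      using Suc by (simp add: between_def open_upper Int_insert_right del: of_nat_Suc)
  qed
qed

lemma sum_mu_le:
  "(\<Sum>x\<in>A \<inter> {y - 1 - int j<..<y}. mu_at A x y)
     \<le> mu (between A (y - 1 - int j) y) (between (- A) (y - 1 - int j) y)"
proof (induction j)
  case 0
  then show ?case by (simp add: mu_0 between_def open_empty)
next
  case (Suc j)
  show ?case
  proof (cases "y - 1 - int j \<in> A")
    case True
    then show ?thesis
      using Suc by (simp add: between_def open_lower Int_insert_right del: of_nat_Suc)
  next
    case False
    then show ?thesis
      using Suc mu_Suc[of "between A (y - 1 - int j) y" "between (- A) (y - 1 - int j) y"]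
      by (simp add: between_def open_lower Int_insert_right del: of_nat_Suc)
  qed
qed

lemma sum_weight_le:
  assumes "A \<subseteq> {1..int n}"
  shows "(\<Sum>x\<in>A. \<Sum>y\<in>- A \<inter> {x<..int n}. weight (nat (y - x)))
    \<le> (real m - L) * real (card A) + (real m - G) * real (n - card A)"
proof -
  have fin: "finite A" using assms finite_subset by blast
  let ?B = "{1..int n} - A"
  have "(\<Sum>x\<in>A. \<Sum>y\<in>- A \<inter> {x<..int n}. weight (nat (y - x)))
    \<le> (\<Sum>x\<in>A. \<Sum>y\<in>- A \<inter> {x<..int n}. lam_at A x y + mu_at A x y)"
  proof (intro sum_mono)
    fix x y assume "y \<in> - A \<inter> {x<..int n}"
    then have "nat (y - x) = Suc (between A x y + between (- A) x y)" using between_compl[of x y A] by simp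
    then show "weight (nat (y - x)) \<le> lam_at A x y + mu_at A x y" using weight_le by simp
  qed
  also have "\<dots> = (\<Sum>x\<in>A. \<Sum>y\<in>- A \<inter> {x<..int n}. lam_at A x y)
     + (\<Sum>x\<in>A. \<Sum>y\<in>- A \<inter> {x<..int n}. mu_at A x y)"
    by (simp add: sum.distrib)
  also have "(\<Sum>x\<in>A. \<Sum>y\<in>- A \<inter> {x<..int n}. mu_at A x y)
     = (\<Sum>x\<in>A. \<Sum>y | y \<in> ?B \<and> x < y. mu_at A x y)"
    using assms by (intro sum.cong refl) auto
  also have "\<dots> = (\<Sum>y\<in>?B. \<Sum>x | x \<in> A \<and> x < y. mu_at A x y)"
    using fin by (intro sum.swap_restrict) auto
  also have "\<dots> \<le> (\<Sum>y\<in>?B. real m - G)"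
  proof (intro sum_mono)
    fix y assume "y \<in> ?B"
    \<comment> \<open>The window starts at 0, so it reaches every point of \<open>A\<close> below
      \<open>y\<close>.\<close>
    then have "{x \<in> A. x < y} = A \<inter> {y - 1 - int (nat y)<..<y}" using assms by auto
    then show "(\<Sum>x | x \<in> A \<and> x < y. mu_at A x y) \<le> real m - G"
      using sum_mu_le[of A y "nat y"] mu_le order_trans by fastforce
  qed
  also have "(\<Sum>x\<in>A. \<Sum>y\<in>- A \<inter> {x<..int n}. lam_at A x y) \<le> (\<Sum>x\<in>A. real m - L)"
  proof (intro sum_mono)
    fix x assume "x \<in> A"
    then have "{x<..int n} = {x<..<x + 1 + int (nat (int n - x))}" using assms by auto
    then show "(\<Sum>y\<in>- A \<inter> {x<..int n}. lam_at A x y) \<le> real m - L"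
      using sum_lam_le[of A x "nat (int n - x)"] lam_le order_trans by fastforce
  qed
  finally show ?thesis
    using assms fin by (simp add: card_Diff_subset mult.commute)
qed

section \<open>Lower bounds for one class and for all classes\<close>

text \<open>The point \<open>x = n - d\<close> sees \<open>min m d\<close> later points within distance \<open>m\<close>; the one half is the
  weight lost if the point at distance exactly \<open>m\<close> exists and lies in another class.\<close>

definition visible :: "nat \<Rightarrow> real" where
  "visible d = real (min m d) - (if m \<le> d then 1 / 2 else 0)"

lemma sum_visible:
  assumes "m \<le> n"
  shows "(\<Sum>d<n. visible d) = (real m - 1 / 2) * real n - (real m)\<^sup>2 / 2"
  using assms
proof (induction n rule: nat_induct_at_least)
  \<comment> \<open>The last \<open>m\<close> points see fewer than \<open>m\<close> later points;
    their deficit is the boundary term \<open>m^2 / 2\<close>.\<close>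
  case base
  have "(\<Sum>d<m. visible d) = (\<Sum>d<m. real d)"
    by (intro sum.cong) (auto simp: visible_def)
  also have "\<dots> = real m * (real m - 1) / 2"
    by (induction m) (auto simp: field_simps)
  finally show ?case by (simp add: power2_eq_square field_simps)
next
  case (Suc n)
  then have "visible n = real m - 1 / 2" by (simp add: visible_def)
  then show ?case using Suc by (simp add: field_simps)
qed

lemma visible_le:
  assumes "A \<subseteq> {1..int n}" "x \<in> A"
  shows "visible (nat (int n - x))
    \<le> real (card (A \<inter> {x<..x + int m})) + (\<Sum>y\<in>- A \<inter> {x<..int n}. weight (nat (y - x)))"
proof -
  define u where "u = min (int n) (x + int m)"
  have xn: "1 \<le> x" "x \<le> int n" using assms by auto
  have A: "A \<inter> {x<..x + int m} = A \<inter> {x<..u}" using assms by (auto simp: u_def)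
  have "card {x<..u} = card (A \<inter> {x<..u}) + card (- A \<inter> {x<..u})"
    by (subst card_Un_disjoint[symmetric]) (auto simp flip: Int_Un_distrib2)
  moreover have "card {x<..u} = min m (nat (int n - x))"
    using xn by (auto simp: u_def min_def)
  ultimately have count:
    "real (min m (nat (int n - x))) = real (card (A \<inter> {x<..u})) + real (card (- A \<inter> {x<..u}))"
    by simp
  \<comment> \<open>Only \<open>y = x + m\<close> has weight 1/2 instead of 1, and it is in range
    only if \<open>m <= n - x\<close>.\<close>
  have "real (card (- A \<inter> {x<..u})) - (if m \<le> nat (int n - x) then 1 / 2 else 0)
    \<le> (\<Sum>y\<in>- A \<inter> {x<..u}. 1 - (if x + int m = y then 1 / 2 else 0))"
    using xn by (auto simp: sum_subtractf u_def)
  also have "\<dots> \<le> (\<Sum>y\<in>- A \<inter> {x<..u}. weight (nat (y - x)))"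
    by (intro sum_mono) (auto simp: weight_def u_def)
  also have "\<dots> \<le> (\<Sum>y\<in>- A \<inter> {x<..int n}. weight (nat (y - x)))"
    by (intro sum_mono2) (auto simp: weight_def u_def)
  finally show ?thesis using count by (simp add: visible_def A)
qed

lemma Psi_ge:
  assumes "A \<subseteq> {1..int n}"
  shows "(\<Sum>x\<in>A. visible (nat (int n - x)))
    - ((real m - L) * real (card A) + (real m - G) * real (n - card A)) \<le> real (Psi m A)"
proof -
  have fin: "finite A" using assms finite_subset by blast
  have "{(x, y). x \<in> A \<and> y \<in> A \<and> x < y \<and> y \<le> x + int m} = (SIGMA x:A. A \<inter> {x<..x + int m})"
    by auto
  then have "real (Psi m A) = (\<Sum>x\<in>A. real (card (A \<inter> {x<..x + int m})))"
    using fin by (simp add: Psi_def card_SigmaI)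
  then show ?thesis
    using sum_mono[OF visible_le[OF assms], of A "\<lambda>x. x"] sum_weight_le[OF assms]
    by (simp add: sum.distrib)
qed

lemma sum_Psi_ge:
  assumes part: "is_partition k n A" and "m \<le> n"
  shows "(L - real k * (real m - G) - 1 / 2) * real n - (real m)\<^sup>2 / 2
    \<le> real (\<Sum>i = 1..k + 1. Psi m (A i))"
proof -
  let ?I = "{1..k + 1}"
  have disj: "disjoint_family_on A ?I" and un: "(\<Union>i\<in>?I. A i) = {1..int n}"
    using part by (auto simp: is_partition_def)
  have sub: "A i \<subseteq> {1..int n}" if "i \<in> ?I" for i using un that by blast
  have fin: "finite (A i)" if "i \<in> ?I" for i using sub[OF that] finite_subset by blast
  have le: "card (A i) \<le> n" if "i \<in> ?I" for i
    using card_mono[OF _ sub[OF that]] by simp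
  have dis: "A i \<inter> A j = {}" if "i \<in> ?I" "j \<in> ?I" "i \<noteq> j" for i j
    using disj that by (auto simp: disjoint_family_on_def)
  have card: "(\<Sum>i\<in>?I. real (card (A i))) = real n"
    using card_UN_disjoint[of ?I A] fin dis un by (simp flip: of_nat_sum)
  have "(\<Sum>i\<in>?I. \<Sum>x\<in>A i. visible (nat (int n - x))) = (\<Sum>x\<in>{1..int n}. visible (nat (int n - x)))"
    unfolding un[symmetric] using fin dis by (intro sum.UNION_disjoint[symmetric]) auto
  also have "\<dots> = (\<Sum>d<n. visible d)"
    by (rule sum.reindex_bij_witness[of _ "\<lambda>d. int n - int d" "\<lambda>x. nat (int n - x)"]) auto
  also have "\<dots> = (real m - 1 / 2) * real n - (real m)\<^sup>2 / 2"
    by (rule sum_visible) fact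
  finally have vis: "(\<Sum>i\<in>?I. \<Sum>x\<in>A i. visible (nat (int n - x))) = \<dots>" .
  have "(\<Sum>i\<in>?I. (real m - L) * real (card (A i)) + (real m - G) * real (n - card (A i)))
    = (\<Sum>i\<in>?I. (real m - L) * real (card (A i)) + (real m - G) * (real n - real (card (A i))))"
    using le by (intro sum.cong) (auto simp: of_nat_diff)
  also have "\<dots> = (real m - L) * real n + (real m - G) * (real k * real n)"
    using card by (simp add: sum.distrib sum_subtractf flip: sum_distrib_left) (simp add: algebra_simps)
  finally have charge: "(\<Sum>i\<in>?I. (real m - L) * real (card (A i)) + (real m - G) * real (n - card (A i)))
    = \<dots>" .
  have "(\<Sum>i\<in>?I. (\<Sum>x\<in>A i. visible (nat (int n - x)))
      - ((real m - L) * real (card (A i)) + (real m - G) * real (n - card (A i))))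
    \<le> (\<Sum>i\<in>?I. real (Psi m (A i)))"
    using sub by (intro sum_mono Psi_ge)
  then show ?thesis
    unfolding sum_subtractf vis charge by (simp add: algebra_simps)
qed

end

theorem theorem4p1:
  fixes k m n :: nat
  assumes "1 \<le> m" and "m \<le> n"
  shows "real (min_Psi k m n) \<ge>
    ((sqrt ((real k)\<^sup>2 + 1) - real k) * real m - 1 / 2) * real n - (real m)\<^sup>2 / 2"
proof -
  define s where "s = sqrt ((real k)\<^sup>2 + 1)"
  have s: "1 \<le> s" "s\<^sup>2 = (real k)\<^sup>2 + 1" by (simp_all add: s_def)
  \<comment> \<open>By Cauchy-Schwarz this choice, with \<open>G = k * L\<close>, maximizes
    \<open>L + k * G\<close> subject to \<open>L^2 + G^2 = m^2\<close>.\<close>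
  interpret budget m "real m / s"
    by unfold_locales (use s mult_right_mono[OF s(1), of "real m"] in \<open>simp_all add: field_simps\<close>)
  have "(real k)\<^sup>2 + 1 \<noteq> 0" using s by auto
  then have "(real m)\<^sup>2 - (real m / s)\<^sup>2 = (real k * real m / s)\<^sup>2"
    by (simp add: power_divide power_mult_distrib s(2) field_simps)
  then have G: "G = real k * real m / s"
    using s by (simp add: G_def)
  have "real m / s - real k * (real m - G) = ((real k)\<^sup>2 + 1) * real m / s - real k * real m"
    by (simp add: G add_divide_distrib algebra_simps power2_eq_square)
  also have "\<dots> = (s - real k) * real m"
    using s(1) unfolding s(2)[symmetric] by (simp add: power2_eq_square algebra_simps)
  finally have slope: "real m / s - real k * (real m - G) = (s - real k) * real m" .
  obtain A where "is_partition k n A" "min_Psi k m n = (\<Sum>i = 1..k + 1. Psi m (A i))"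
    using min_Psi_attained by blast
  then show ?thesis
    using sum_Psi_ge[of k n A] assms(2) unfolding slope by (simp flip: s_def)
qed

end
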